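(* Let $K$ be a knot in 3-space with non-commutative $A$-polynomial $A_K(M,L,q)$, $A$-polynomial $A_K(M,L)$, and tropical curve $\Gamma_K$. Suppose that $A_K(M,L,q)$ is good, and that the AJ Conjecture holds for $K$, i.e. there is a polynomial $B_K(M)\in\mathbb{Z}[M]$ such that $$A_K(M,L,1)=B_K(M)\,A_K(M^{1/2},L).$$ Then $\Gamma_K$ is dual to a Newton subdivision of the Newton polygon (in the coordinates ($L$-exponent, $M$-exponent)) of $A_K(M^{1/2},L)\,B_K(M)$, that is, of the $A$-polynomial of $K$ multiplied by a polynomial in $M$.
   Context: **Operators.** The operators $M,L$ act on sequences $f=(f_n(q))_{n\in\mathbb{N}}$ of elements of $\mathbb{Q}(q)$ by $(Mf)_n=q^nf_n$ and $(Lf)_n=f_{n+1}$; they satisfy $LM=qML$. The $q$-Weyl algebra is $W=\mathbb{Z}[q^{\pm1}]\langle M,L\rangle/(LM-qML)$, and the localized $q$-Weyl algebra is $W_{\mathrm{loc}}=\mathbb{Q}(M,q)\langle L\rangle/(L\,a(M,q)-a(Mq,q)L : a\in\mathbb{Q}(M,q))$, in which every left ideal is principal. A coefficient $a(M,q)\in\mathbb{Q}(M,q)$ acts by multiplying the $n$-th term by $a(q^n,q)$, defined for all large $n$; identities $Pf=0$ with $P\in W_{\mathrm{loc}}$ are understood for all sufficiently large $n$. A sequence $f$ is $q$-holonomic if it satisfies $\sum_{i=0}^d a_i(q^n,q)f_{n+i}(q)=0$ for all $n$, for some $a_i(M,q)\in\mathbb{Z}[M,q]$ with $a_d\ne0$.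 For $f$ $q$-holonomic, the left ideal $\{P\in W_{\mathrm{loc}}: Pf=0\}$ is nonzero; its monic (in $L$) generator, multiplied on the left by an element of $\mathbb{Q}(M,q)$ so as to have the form $P_f=\sum_i a_i(M,q)L^i$ with $a_i\in\mathbb{Z}[M,q]$ of greatest common divisor $1$, is the homogeneous annihilator $P_f$ of $f$ (unique up to sign). **Non-commutative $A$-polynomial.** Let $J_{K,n}(q)\in\mathbb{Z}[q^{\pm1}]$ be the colored Jones polynomial of $K$ colored by the $(n+1)$-dimensional irreducible representation of $\mathfrak{sl}_2$, normalized to be $1$ at the unknot. The sequence $(J_{K,n}(q))_{n\ge0}$ is $q$-holonomic (known theorem). The non-commutative $A$-polynomial $A_K(M,L,q)$ is its homogeneous annihilator, written with powers of $M$ to the left of powers of $L$; $A_K(M,L,1)$ is the commutative polynomial in $M,L$ obtained by setting $q=1$. **$A$-polynomial.** $A_K(M,L)$ denotes the $A$-polynomial of $K$ of Cooper–Culler–Gillet–Long–Shalen: the defining polynomial of (the one-dimensional part of the Zariski closure of) the set of pairs $(M,L)\in\mathbb{C}^*\times\mathbb{C}^*$ of eigenvalues of the meridian and the longitude (with respect to a common eigenvector) under representations $\pi_1(S^3\setminus K)\to \mathrm{SL}(2,\mathbb{C})$, with the factor $L-1$ coming from abelian representations included. It involves only even powers of $M$, so that $A_K(M^{1/2},L)$ is a polynomial in $M,L$. **Polytopes and goodness.** For $P=\sum_{(i,j,k)\in\mathcal{A}}a_{i,j,k}q^kM^jL^i\in W$ with $\mathcal{A}$ finite and all $a_{i,j,k}\in\mathbb{Z}\setminus\{0\}$,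 let $N_{P,0}\subset\mathbb{R}^2$ be the convex hull of $\{(i,j):(i,j,k)\in\mathcal{A}\}$ and let $N_{P,1}\subset\mathbb{R}^2$ be the convex hull of the exponents $(i,j)$ of the monomials $M^jL^i$ occurring with nonzero coefficient in $P(M,L,1)$. $P$ is good if $N_{P,1}=N_{P,0}$. **Tropical curve.** The tropical polynomial of $P$ is the function $(x,y)\mapsto\min_{(i,j,k)\in\mathcal{A}}\{ix+jy-k\}$ on $\mathbb{R}^2$, and the tropical curve $\Gamma_P$ is the set of points at which this function is not linear (i.e. where the minimum is attained by at least two distinct linear functions). $\Gamma_K$ is the tropical curve $\Gamma_P$ for $P=A_K(M,L,q)$. **Newton subdivisions and duality.** A Newton subdivision of a lattice polygon $N$ is a polyhedral subdivision of $N$ obtained by projecting to $\mathbb{R}^2$ the lower faces of the convex hull of a finite set of points $(i,j,c)\in\mathbb{Z}^2\times\mathbb{Q}$ whose projections $(i,j)$ have convex hull $N$. A tropical curve $\Gamma$ is dual to a subdivision of $N$ if there is an inclusion-reversing bijection between the cells of the decomposition of $\mathbb{R}^2$ induced by $\Gamma$ and the cells of the subdivision, under which vertices of $\Gamma$ correspond to two-dimensional cells, edges (bounded edges and rays) of $\Gamma$ correspond to edges of the subdivision perpendicular to them (rays corresponding to edges on the boundary of $N$), and connected components of $\mathbb{R}^2\setminus\Gamma$ correspond to vertices of the subdivision. *)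

theory Defs
  imports
    "HOL-Analysis.Analysis"
    "HOL-Computational_Algebra.Computational_Algebra"
    "HOL-Homology.Simplices"
begin

section \<open>Knots in 3-space\<close>

definition smooth_curve :: "(real \<Rightarrow> real^3) \<Rightarrow> bool" where
  "smooth_curve \<gamma> \<longleftrightarrow>
     (\<exists>D :: nat \<Rightarrow> real \<Rightarrow> real^3. D 0 = \<gamma> \<and>
        (\<forall>k t. (D k has_vector_derivative D (Suc k) t) (at t)))"

text \<open>A smooth embedding of the circle \<open>\<real>/\<int>\<close> with image \<open>K\<close>.\<close>

definition knot_parametrization :: "(real^3) set \<Rightarrow> (real \<Rightarrow> real^3) \<Rightarrow> bool" where
  "knot_parametrization K \<gamma> \<longleftrightarrow>
     smooth_curve \<gamma> \<and> (\<forall>t. \<gamma> (t + 1) = \<gamma> t) \<and>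
     (\<forall>t. vector_derivative \<gamma> (at t) \<noteq> 0) \<and> inj_on \<gamma> {0..<1} \<and> range \<gamma> = K"

definition knot :: "(real^3) set \<Rightarrow> bool" where
  "knot K \<longleftrightarrow> (\<exists>\<gamma>. knot_parametrization K \<gamma>)"


section \<open>Knot diagrams\<close>

text \<open>The projection is along the third coordinate axis, seen from above: larger third coordinate
  means overcrossing.\<close>

definition double_points :: "(real \<Rightarrow> real^3) \<Rightarrow> (real \<times> real) set" where
  "double_points \<gamma> =
     {(s, t). s \<in> {0..<1} \<and> t \<in> {0..<1} \<and> s \<noteq> t \<and> \<gamma> s $ 1 = \<gamma> t $ 1 \<and> \<gamma> s $ 2 = \<gamma> t $ 2}"

definition planar_det :: "real^3 \<Rightarrow> real^3 \<Rightarrow> real" where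
  "planar_det v w = v $ 1 * w $ 2 - v $ 2 * w $ 1"

definition regular_projection :: "(real \<Rightarrow> real^3) \<Rightarrow> bool" where
  "regular_projection \<gamma> \<longleftrightarrow>
     (\<forall>t. vector_derivative \<gamma> (at t) $ 1 \<noteq> 0 \<or> vector_derivative \<gamma> (at t) $ 2 \<noteq> 0) \<and>
     finite (double_points \<gamma>) \<and>
     (\<forall>(s, t) \<in> double_points \<gamma>.
        planar_det (vector_derivative \<gamma> (at s)) (vector_derivative \<gamma> (at t)) \<noteq> 0) \<and>
     (\<forall>s t u. (s, t) \<in> double_points \<gamma> \<and> (s, u) \<in> double_points \<gamma> \<longrightarrow> t = u)"

text \<open>A diagram with \<open>c\<close> crossings is recorded by its signed Gauss code. The \<open>2c\<close> passages through
  crossings are numbered \<open>0, \<dots>, 2c - 1\<close> along the knot, and a crossing is a triple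
  (number of the overpassage, number of the underpassage, whether the crossing is positive).\<close>

type_synonym gauss_code = "(nat \<times> nat \<times> bool) set"

definition gauss_code_of :: "(real \<Rightarrow> real^3) \<Rightarrow> gauss_code" where
  "gauss_code_of \<gamma> =
     (let passage = (\<lambda>t. card {r \<in> fst ` double_points \<gamma>. r < t})
      in {(passage s, passage t,
           planar_det (vector_derivative \<gamma> (at s)) (vector_derivative \<gamma> (at t)) > 0) | s t.
          (s, t) \<in> double_points \<gamma> \<and> \<gamma> s $ 3 > \<gamma> t $ 3})"

text \<open>A projection of \<open>K\<close> in an arbitrary direction is the vertical projection after a rotation.\<close>

definition diagram_of :: "(real^3) set \<Rightarrow> gauss_code \<Rightarrow> bool" where
  "diagram_of K D \<longleftrightarrow>
     (\<exists>\<gamma> (R :: real^3^3). knot_parametrization K \<gamma> \<and> rotation_matrix R \<and>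
        regular_projection (\<lambda>t. R *v \<gamma> t) \<and> D = gauss_code_of (\<lambda>t. R *v \<gamma> t))"

definition writhe :: "gauss_code \<Rightarrow> int" where
  "writhe D = (\<Sum>(i, j, pos) \<in> D. if pos then 1 else - 1)"


section \<open>The colored Jones polynomial\<close>

text \<open>The blackboard \<open>k\<close>-cable of a diagram. Its strands are numbered from left to right.
  The arc \<open>(i, s, r)\<close> is the piece of strand \<open>s\<close> that enters the \<open>r\<close>-th of the \<open>k\<close> crossings
  which this strand meets at passage \<open>i\<close> of the original diagram. Without crossings, strand \<open>s\<close> is
  the single closed arc \<open>(0, s, 0)\<close>.\<close>

type_synonym arc = "nat \<times> nat \<times> nat"

definition cable_arcs :: "gauss_code \<Rightarrow> nat \<Rightarrow> arc set" where
  "cable_arcs D k =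
     (if D = {} then {0} \<times> {..<k} \<times> {0} else {..<2 * card D} \<times> {..<k} \<times> {..<k})"

fun next_arc :: "gauss_code \<Rightarrow> nat \<Rightarrow> arc \<Rightarrow> arc" where
  "next_arc D k (i, s, r) =
     (if r + 1 < k then (i, s, r + 1) else ((i + 1) mod (2 * card D), s, 0))"

text \<open>A crossing is a quadruple \<open>(a, b, c, d)\<close> of arcs, listed counterclockwise starting from the
  incoming lower arc. The underpassing strand \<open>u\<close> meets the overpassing strands in decreasing order
  at a positive crossing and in increasing order at a negative one; dually for the overpassing
  strand \<open>s\<close>.\<close>

fun cable_crossing :: "gauss_code \<Rightarrow> nat \<Rightarrow> nat \<times> nat \<times> bool \<Rightarrow> nat \<Rightarrow> nat \<Rightarrow> arc \<times> arc \<times> arc \<times> arc"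
  where
  "cable_crossing D k (i, j, pos) s u =
     (if pos then
        let a = (j, u, k - 1 - s); d = (i, s, u) in (a, next_arc D k d, next_arc D k a, d)
      else
        let a = (j, u, s); b = (i, s, k - 1 - u) in (a, b, next_arc D k a, next_arc D k b))"

definition cable_crossings :: "gauss_code \<Rightarrow> nat \<Rightarrow> (arc \<times> arc \<times> arc \<times> arc) set" where
  "cable_crossings D k = {cable_crossing D k x s u | x s u. x \<in> D \<and> s < k \<and> u < k}"

text \<open>The arcs joined in the Kauffman state in which exactly the crossings in \<open>S\<close> get the
  \<open>A\<close>-smoothing.\<close>

definition smoothing ::
  "(arc \<times> arc \<times> arc \<times> arc) set \<Rightarrow> (arc \<times> arc \<times> arc \<times> arc) set \<Rightarrow> (arc \<times> arc) set" where
  "smoothing X S =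
     (\<Union>(a, b, c, d) \<in> X. if (a, b, c, d) \<in> S then {(a, b), (c, d)} else {(a, d), (b, c)})"

definition loop_number :: "'a set \<Rightarrow> ('a \<times> 'a) set \<Rightarrow> nat" where
  "loop_number V r = card (V // {(x, y) \<in> V \<times> V. (x, y) \<in> (r \<union> r\<inverse>)\<^sup>*})"

text \<open>We model \<open>\<rat>(q)\<close> as the fraction field of \<open>\<int>[q]\<close>. Kauffman brackets are computed in a copy of
  this field whose variable is called \<open>A\<close>; the two are related by \<open>q = A\<^sup>4\<close>.\<close>

definition variable :: "int poly fract" where
  "variable = to_fract [:0, 1:]"

definition loop_value :: "int poly fract" where
  "loop_value = - (variable ^ 2) - inverse variable ^ 2"

definition cable_bracket :: "gauss_code \<Rightarrow> nat \<Rightarrow> int poly fract" where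
  "cable_bracket D k =
     (let X = cable_crossings D k
      in \<Sum>S \<in> Pow X. variable powi (2 * int (card S) - int (card X)) *
           loop_value ^ loop_number (cable_arcs D k) (smoothing X S))"

text \<open>In the representation ring of \<open>\<ss>\<ll>\<^sub>2\<close>, the irreducible representation of dimension \<open>n + 1\<close> is
  the \<open>n\<close>-th Chebyshev polynomial in the two-dimensional one, and tensor powers of the latter
  correspond to parallel strands.\<close>

fun chebyshev :: "nat \<Rightarrow> int poly" where
  "chebyshev 0 = 1"
| "chebyshev (Suc 0) = [:0, 1:]"
| "chebyshev (Suc (Suc n)) = [:0, 1:] * chebyshev (Suc n) - chebyshev n"

definition colored_bracket :: "gauss_code \<Rightarrow> nat \<Rightarrow> int poly fract" where
  "colored_bracket D n = (\<Sum>k\<le>n. of_int (coeff (chebyshev n) k) * cable_bracket D k)"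

text \<open>The power of the twist factor corrects the framing to zero, and the empty code, the diagram of
  the unknot without crossings, provides the normalization.\<close>

definition colored_Jones_A :: "gauss_code \<Rightarrow> nat \<Rightarrow> int poly fract" where
  "colored_Jones_A D n =
     ((- 1) ^ n * variable ^ (n\<^sup>2 + 2 * n)) powi (- writhe D) *
     colored_bracket D n / colored_bracket {} n"

text \<open>The Laurent polynomial \<open>p(q) / q\<^sup>m\<close> that becomes the above after substituting \<open>q = A\<^sup>4\<close>. With
  this choice of \<open>q\<close> rather than its inverse, \<open>n = 1\<close> gives \<open>q + q\<^sup>3 - q\<^sup>4\<close> for the left-handed
  trefoil. This is the chirality that matches the orientation conventions for the \<open>A\<close>-polynomial
  below: the right-handed trefoil has \<open>A\<close>-polynomial \<open>(L - 1)(L M\<^sup>6 + 1)\<close>.\<close>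

definition colored_Jones :: "(real^3) set \<Rightarrow> nat \<Rightarrow> int poly fract" where
  "colored_Jones K n =
     (let D = (SOME D. diagram_of K D)
      in THE f. \<exists>p m. f = to_fract p / variable ^ m \<and>
           colored_Jones_A D n = to_fract (pcompose p (monom 1 4)) / variable ^ (4 * m))"


section \<open>The localized \<open>q\<close>-Weyl algebra\<close>

text \<open>\<open>\<int>[M,q]\<close> is \<^typ>\<open>int poly poly\<close> with outer variable \<open>M\<close> and inner variable \<open>q\<close>, so \<open>\<rat>(M,q)\<close> is
  \<^typ>\<open>int poly poly fract\<close>. Elements of \<open>W\<^sub>l\<^sub>o\<^sub>c\<close> are written with coefficients to the left of the powers
  of \<open>L\<close>. As left vector spaces over \<open>\<rat>(M,q)\<close> they are ordinary polynomials in \<open>L\<close>, but they are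
  multiplied by \<open>skew_mult\<close> and not by the multiplication of polynomials.\<close>

type_synonym wloc = "int poly poly fract poly"

definition shift_M :: "int poly poly \<Rightarrow> int poly poly" where
  "shift_M a = pcompose a [:0, [:0, 1:]:]"

definition shift :: "int poly poly fract \<Rightarrow> int poly poly fract" where
  "shift x = (let (a, b) = quot_of_fract x in Fract (shift_M a) (shift_M b))"

definition skew_mult :: "wloc \<Rightarrow> wloc \<Rightarrow> wloc" where
  "skew_mult P Q =
     (\<Sum>i\<le>degree P. \<Sum>j\<le>degree Q. monom (coeff P i * (shift ^^ i) (coeff Q j)) (i + j))"

text \<open>\<open>a(q\<^sup>n, q)\<close>. For small \<open>n\<close> the denominator may vanish; the value is then irrelevant.\<close>

definition eval_M :: "int poly poly fract \<Rightarrow> nat \<Rightarrow> int poly fract" where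
  "eval_M x n =
     (let (a, b) = quot_of_fract x
      in to_fract (poly a (monom 1 n)) / to_fract (poly b (monom 1 n)))"

definition act :: "wloc \<Rightarrow> (nat \<Rightarrow> int poly fract) \<Rightarrow> nat \<Rightarrow> int poly fract" where
  "act P f n = (\<Sum>i\<le>degree P. eval_M (coeff P i) n * f (n + i))"

definition annihilator :: "(nat \<Rightarrow> int poly fract) \<Rightarrow> wloc set" where
  "annihilator f = {P. eventually (\<lambda>n. act P f n = 0) sequentially}"

text \<open>An operator \<open>\<Sum>\<^sub>i a\<^sub>i(M,q) L\<^sup>i\<close> with \<open>a\<^sub>i \<in> \<int>[M,q]\<close> is an element of \<^typ>\<open>int poly poly poly\<close>, whose
  variables are, from the outside to the inside, \<open>L\<close>, \<open>M\<close>, \<open>q\<close>. The homogeneous annihilator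
  is unique only up to sign, hence a predicate.\<close>

definition homogeneous_annihilator ::
  "(nat \<Rightarrow> int poly fract) \<Rightarrow> int poly poly poly \<Rightarrow> bool" where
  "homogeneous_annihilator f P \<longleftrightarrow>
     (\<exists>G c. lead_coeff G = 1 \<and> annihilator f = {skew_mult R G | R. True} \<and>
        c \<noteq> 0 \<and> map_poly to_fract P = smult c G) \<and>
     content P = 1"

definition noncommutative_A_polynomial :: "(real^3) set \<Rightarrow> int poly poly poly \<Rightarrow> bool" where
  "noncommutative_A_polynomial K P \<longleftrightarrow> homogeneous_annihilator (colored_Jones K) P"

definition at_q_one :: "int poly poly poly \<Rightarrow> int poly poly" where
  "at_q_one P = map_poly (map_poly (\<lambda>c. poly c 1)) P"


section \<open>The \<open>A\<close>-polynomial\<close>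

definition loops_at :: "(real^3) set \<Rightarrow> real^3 \<Rightarrow> (real \<Rightarrow> real^3) set" where
  "loops_at X x = {p. path p \<and> path_image p \<subseteq> X \<and> pathstart p = x \<and> pathfinish p = x}"

text \<open>A representation of \<open>\<pi>\<^sub>1(X, x)\<close> in \<open>SL(2, \<complex>)\<close>, as a function on loops that depends only on
  homotopy classes.\<close>

definition SL2_representation ::
  "(real^3) set \<Rightarrow> real^3 \<Rightarrow> ((real \<Rightarrow> real^3) \<Rightarrow> complex^2^2) \<Rightarrow> bool" where
  "SL2_representation X x \<rho> \<longleftrightarrow>
     (\<forall>p \<in> loops_at X x. det (\<rho> p) = 1) \<and>
     (\<forall>p \<in> loops_at X x. \<forall>p' \<in> loops_at X x. homotopic_paths X p p' \<longrightarrow> \<rho> p = \<rho> p') \<and>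
     (\<forall>p \<in> loops_at X x. \<forall>p' \<in> loops_at X x. \<rho> (p +++ p') = \<rho> p ** \<rho> p')"

text \<open>An orientation-preserving parametrization of a closed tubular neighborhood of \<open>K\<close> by
  \<open>\<real>/\<int> \<times> D\<^sup>2\<close>; the first coordinate is the one along \<open>K\<close>.\<close>

definition solid_cylinder :: "(real^3) set" where
  "solid_cylinder = {p. (p $ 2)\<^sup>2 + (p $ 3)\<^sup>2 \<le> 1}"

definition tubular_neighborhood :: "(real^3) set \<Rightarrow> (real^3 \<Rightarrow> real^3) \<Rightarrow> bool" where
  "tubular_neighborhood K h \<longleftrightarrow>
     (\<forall>p. h (p + axis 1 1) = h p) \<and>
     inj_on h {p \<in> solid_cylinder. 0 \<le> p $ 1 \<and> p $ 1 < 1} \<and>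
     (\<forall>p \<in> solid_cylinder. h differentiable (at p) \<and>
        det (matrix (frechet_derivative h (at p))) > 0) \<and>
     range (\<lambda>t. h (vector [t, 0, 0])) = K"

text \<open>By the positivity of the Jacobian, the meridian has linking number \<open>+1\<close> with \<open>K\<close> when \<open>K\<close> is
  oriented like the longitude.\<close>

definition meridian :: "(real^3 \<Rightarrow> real^3) \<Rightarrow> real \<Rightarrow> real^3" where
  "meridian h t = h (vector [0, cos (2 * pi * t), sin (2 * pi * t)])"

definition longitude :: "(real^3 \<Rightarrow> real^3) \<Rightarrow> real \<Rightarrow> real^3" where
  "longitude h t = h (vector [t, 1, 0])"

text \<open>A loop, viewed as a singular 1-simplex with barycentric coordinates \<open>x 0\<close> and \<open>x 1\<close>, bounds in
  singular homology.\<close>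

definition null_homologous :: "(real^3) set \<Rightarrow> (real \<Rightarrow> real^3) \<Rightarrow> bool" where
  "null_homologous X p \<longleftrightarrow>
     singular_relboundary 1 (top_of_set X) {} (frag_of (restrict (\<lambda>x. p (x 1)) (standard_simplex 1)))"

definition peripheral_eigenvalues :: "(real^3) set \<Rightarrow> (complex \<times> complex) set" where
  "peripheral_eigenvalues K =
     {(m, l). m \<noteq> 0 \<and> l \<noteq> 0 \<and>
        (\<exists>h \<rho> v. tubular_neighborhood K h \<and> null_homologous (- K) (longitude h) \<and>
           SL2_representation (- K) (h (vector [0, 1, 0])) \<rho> \<and>
           v \<noteq> 0 \<and> \<rho> (meridian h) *v v = m *s v \<and> \<rho> (longitude h) *v v = l *s v)}"

text \<open>Polynomials in \<open>M\<close>, \<open>L\<close> have \<open>L\<close> as outer and \<open>M\<close> as inner variable, as above.\<close>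

definition eval_ML :: "complex poly poly \<Rightarrow> complex \<times> complex \<Rightarrow> complex" where
  "eval_ML p = (\<lambda>(m, l). poly (map_poly (\<lambda>a. poly a m) p) l)"

definition zariski_closed :: "(complex \<times> complex) set \<Rightarrow> bool" where
  "zariski_closed Z \<longleftrightarrow> (\<exists>S. Z = {z. \<forall>p \<in> S. eval_ML p z = 0})"

definition zariski_closure :: "(complex \<times> complex) set \<Rightarrow> (complex \<times> complex) set" where
  "zariski_closure E = \<Inter> {Z. zariski_closed Z \<and> E \<subseteq> Z}"

definition zariski_irreducible :: "(complex \<times> complex) set \<Rightarrow> bool" where
  "zariski_irreducible Z \<longleftrightarrow>
     zariski_closed Z \<and> Z \<noteq> {} \<and>
     (\<forall>Z1 Z2. zariski_closed Z1 \<and> zariski_closed Z2 \<and> Z = Z1 \<union> Z2 \<longrightarrow> Z = Z1 \<or> Z = Z2)"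

definition irreducible_component ::
  "(complex \<times> complex) set \<Rightarrow> (complex \<times> complex) set \<Rightarrow> bool" where
  "irreducible_component C Z \<longleftrightarrow>
     zariski_irreducible C \<and> C \<subseteq> Z \<and> (\<forall>C'. zariski_irreducible C' \<and> C \<subseteq> C' \<and> C' \<subseteq> Z \<longrightarrow> C' = C)"

definition one_dimensional :: "(complex \<times> complex) set \<Rightarrow> bool" where
  "one_dimensional C \<longleftrightarrow>
     (\<exists>C0. zariski_irreducible C0 \<and> C0 \<subset> C) \<and>
     \<not> (\<exists>C0 C1. zariski_irreducible C0 \<and> zariski_irreducible C1 \<and> C0 \<subset> C1 \<and> C1 \<subset> C)"

definition one_dimensional_part :: "(complex \<times> complex) set \<Rightarrow> (complex \<times> complex) set" where
  "one_dimensional_part Z = \<Union> {C. irreducible_component C Z \<and> one_dimensional C}"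

text \<open>The defining polynomial of a curve generates its vanishing ideal. It is scaled to be a
  primitive integer polynomial, which determines it up to sign. The abelian representations
  are included, hence so is the factor \<open>L - 1\<close>.\<close>

definition A_polynomial :: "(real^3) set \<Rightarrow> int poly poly \<Rightarrow> bool" where
  "A_polynomial K A \<longleftrightarrow>
     (\<forall>d :: int. [:[:d:]:] dvd A \<longrightarrow> is_unit d) \<and>
     {p. \<forall>z \<in> one_dimensional_part (zariski_closure (peripheral_eigenvalues K)). eval_ML p z = 0} =
     {p. map_poly (map_poly of_int) A dvd p}"

text \<open>\<open>A(M\<^bsup>1/2\<^esup>, L)\<close> for a polynomial \<open>A\<close> that involves only even powers of \<open>M\<close>.\<close>

definition sqrt_M :: "int poly poly \<Rightarrow> int poly poly" where
  "sqrt_M A = (THE A'. map_poly (\<lambda>a. pcompose a (monom 1 2)) A' = A)"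


section \<open>Newton polygons and tropical curves\<close>

text \<open>The exponents \<open>(i, j, k)\<close> of the monomials \<open>q\<^sup>k M\<^sup>j L\<^sup>i\<close>.\<close>

definition exponents :: "int poly poly poly \<Rightarrow> (nat \<times> nat \<times> nat) set" where
  "exponents P = {(i, j, k). coeff (coeff (coeff P i) j) k \<noteq> 0}"

definition newton_polygon_0 :: "int poly poly poly \<Rightarrow> (real \<times> real) set" where
  "newton_polygon_0 P = convex hull ((\<lambda>(i, j, k). (real i, real j)) ` exponents P)"

definition newton_polygon :: "int poly poly \<Rightarrow> (real \<times> real) set" where
  "newton_polygon p = convex hull {(real i, real j) | i j. coeff (coeff p i) j \<noteq> 0}"

definition newton_polygon_1 :: "int poly poly poly \<Rightarrow> (real \<times> real) set" where
  "newton_polygon_1 P = newton_polygon (at_q_one P)"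

definition good :: "int poly poly poly \<Rightarrow> bool" where
  "good P \<longleftrightarrow> newton_polygon_1 P = newton_polygon_0 P"

definition tropical_monomial :: "nat \<times> nat \<times> nat \<Rightarrow> real \<times> real \<Rightarrow> real" where
  "tropical_monomial = (\<lambda>(i, j, k) (x, y). real i * x + real j * y - real k)"

definition tropical_polynomial :: "int poly poly poly \<Rightarrow> real \<times> real \<Rightarrow> real" where
  "tropical_polynomial P z = Min ((\<lambda>a. tropical_monomial a z) ` exponents P)"

definition tropical_curve :: "int poly poly poly \<Rightarrow> (real \<times> real) set" where
  "tropical_curve P =
     {z. \<exists>a \<in> exponents P. \<exists>b \<in> exponents P. a \<noteq> b \<and>
        tropical_monomial a z = tropical_polynomial P z \<and>
        tropical_monomial b z = tropical_polynomial P z}"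


section \<open>Newton subdivisions and duality\<close>

text \<open>A lower face is cut out by a supporting hyperplane whose inner normal has positive last
  coordinate, which can be scaled to 1.\<close>

definition lower_face :: "((real \<times> real) \<times> real) set \<Rightarrow> ((real \<times> real) \<times> real) set \<Rightarrow> bool" where
  "lower_face F Q \<longleftrightarrow>
     F \<noteq> {} \<and>
     (\<exists>u b. Q \<subseteq> {p. inner (u, 1) p \<ge> b} \<and> F = Q \<inter> {p. inner (u, 1) p = b})"

definition newton_subdivision :: "(real \<times> real) set \<Rightarrow> (real \<times> real) set set \<Rightarrow> bool" where
  "newton_subdivision N \<S> \<longleftrightarrow>
     (\<exists>X :: ((int \<times> int) \<times> rat) set. finite X \<and>
        convex hull ((\<lambda>((i, j), c). (real_of_int i, real_of_int j)) ` X) = N \<and>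
        \<S> = {fst ` F | F.
          lower_face F (convex hull
            ((\<lambda>((i, j), c). ((real_of_int i, real_of_int j), real_of_rat c)) ` X))})"

text \<open>The decomposition of the plane induced by \<open>\<Gamma>\<close>: vertices are the points near which \<open>\<Gamma>\<close> is not a
  straight line, and edges are the pieces into which the vertices cut \<open>\<Gamma>\<close>. If \<open>\<Gamma>\<close> contains a whole
  line without a vertex, then this line is an unbounded edge. All cells are taken to be closed.\<close>

definition curve_vertices :: "(real \<times> real) set \<Rightarrow> (real \<times> real) set" where
  "curve_vertices \<Gamma> =
     {v \<in> \<Gamma>. \<not> (\<exists>d e. d \<noteq> 0 \<and> e > 0 \<and> \<Gamma> \<inter> ball v e = range (\<lambda>t. v + t *\<^sub>R d) \<inter> ball v e)}"

definition vertex_cells :: "(real \<times> real) set \<Rightarrow> (real \<times> real) set set" where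
  "vertex_cells \<Gamma> = (\<lambda>v. {v}) ` curve_vertices \<Gamma>"

definition edge_cells :: "(real \<times> real) set \<Rightarrow> (real \<times> real) set set" where
  "edge_cells \<Gamma> = closure ` components (\<Gamma> - curve_vertices \<Gamma>)"

definition region_cells :: "(real \<times> real) set \<Rightarrow> (real \<times> real) set set" where
  "region_cells \<Gamma> = closure ` components (- \<Gamma>)"

text \<open>An unbounded edge (a ray, or a line as above) corresponds to an edge on the boundary of \<open>N\<close>.
  If \<open>N\<close> is only a segment, then \<open>frontier N = N\<close>.\<close>

definition dual_to_subdivision ::
  "(real \<times> real) set \<Rightarrow> (real \<times> real) set \<Rightarrow> (real \<times> real) set set \<Rightarrow> bool" where
  "dual_to_subdivision \<Gamma> N \<S> \<longleftrightarrow>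
     (\<exists>\<phi>. bij_betw \<phi> (vertex_cells \<Gamma> \<union> edge_cells \<Gamma> \<union> region_cells \<Gamma>) \<S> \<and>
        (\<forall>c \<in> vertex_cells \<Gamma> \<union> edge_cells \<Gamma> \<union> region_cells \<Gamma>.
         \<forall>c' \<in> vertex_cells \<Gamma> \<union> edge_cells \<Gamma> \<union> region_cells \<Gamma>. c \<subseteq> c' \<longleftrightarrow> \<phi> c' \<subseteq> \<phi> c) \<and>
        (\<forall>c \<in> vertex_cells \<Gamma>. aff_dim (\<phi> c) = 2) \<and>
        (\<forall>c \<in> edge_cells \<Gamma>. aff_dim (\<phi> c) = 1 \<and>
           (\<forall>x \<in> c. \<forall>y \<in> c. \<forall>a \<in> \<phi> c. \<forall>b \<in> \<phi> c. inner (x - y) (a - b) = 0) \<and>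
           (\<not> bounded c \<longleftrightarrow> \<phi> c \<subseteq> frontier N)) \<and>
        (\<forall>c \<in> region_cells \<Gamma>. aff_dim (\<phi> c) = 0))"

end

theory Submission
  imports Defs
begin

text \<open>
  The tropical polynomial of \<open>P\<close> is a minimum \<open>m\<close> of finitely many affine functions
  \<open>z \<mapsto> p \<bullet> z + c\<close>, one for each monomial, with slope \<open>p = (i, j)\<close> and constant \<open>c = - k\<close>. The proof
  is the duality between such a concave function and the lower convex hull of the points \<open>(p, c)\<close>.

  Send \<open>z\<close> to the convex hull of the slopes of the functions that are minimal at \<open>z\<close>. Since these
  functions are cut out among all \<open>(p, c)\<close> by minimality of the inner product with \<open>(z, 1)\<close>, this hull
  is the projection of a lower face, and every lower face arises in this way
  (\<open>lower_face_convex_hull_iff\<close>). Its elements are supergradients of \<open>m\<close> at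
  \<open>z\<close> (\<open>dual_cell_supergradient\<close>). A slope that is a supergradient at two points prescribes the
  difference of the values of \<open>m\<close> there, and for this reason the hull determines the minimal
  functions and grows exactly when their set grows (\<open>dual_cell_subset_iff\<close>). Hence the closed polyhedra on which given
  functions are minimal correspond bijectively to the cells of the subdivision, with inclusions
  reversed.

  What remains is to recognize these polyhedra in the topology of the tropical curve. The point is
  that the set of minimal functions cannot change along a connected set on which the dimension of
  the dual cell is constant: near \<open>z\<close> it can only shrink, and shrinking without loss of dimension is
  impossible (\<open>active_eq_of_aff_dim_eq\<close>). Therefore the components of the locus of dual dimension
  \<open>k\<close> are the relatively open polyhedra (\<open>components_equidimensional\<close>). In the plane, dimension \<open>0\<close>
  is the complement of the curve, dimension \<open>1\<close> consists of the points where the curve is locally a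
  line, and dimension \<open>2\<close> of its vertices (\<open>curve_vertices_corner_locus\<close>). A polyhedron is unbounded
  precisely if its dual cell lies on the boundary of the hull of all slopes (\<open>unbounded_cell_iff\<close>).

  Finally, goodness identifies the Newton polygon of \<open>P\<close> with that of \<open>P(M, L, 1)\<close>, which by the AJ
  relation is the polygon of the product of the \<open>A\<close>-polynomial and \<open>B\<close>.
\<close>

section \<open>The minimum of finitely many affine functions\<close>

text \<open>A pair \<open>(p, c)\<close> stands for the affine function \<open>z \<mapsto> inner z p + c\<close>, whose value at \<open>z\<close> is the
  inner product with \<open>(z, 1)\<close>. The functions minimal at \<open>z\<close> are thus the points of \<open>T\<close> on
  the hyperplane with normal \<open>(z, 1)\<close> that supports \<open>T\<close> from below.\<close>

locale affine_minimum =
  fixes T :: "('a::euclidean_space \<times> real) set"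
  assumes finite_T: "finite T" and nonempty_T: "T \<noteq> {}"
begin

definition envelope :: "'a \<Rightarrow> real" where
  "envelope z = Min ((\<lambda>a. inner (z, 1) a) ` T)"

definition active :: "'a \<Rightarrow> ('a \<times> real) set" where
  "active z = {a \<in> T. inner (z, 1) a = envelope z}"

definition dual_cell :: "'a \<Rightarrow> 'a set" where
  "dual_cell z = convex hull (fst ` active z)"

text \<open>The closed polyhedron, in the decomposition of the space by the envelope, that contains \<open>z\<close> in
  its relative interior; this relative interior is called the stratum of \<open>z\<close>.\<close>

definition cell :: "'a \<Rightarrow> 'a set" where
  "cell z = {w. active z \<subseteq> active w}"

definition stratum :: "'a \<Rightarrow> 'a set" where
  "stratum z = {w. active w = active z}"

lemma envelope_le: "a \<in> T \<Longrightarrow> envelope z \<le> inner z (fst a) + snd a"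
  using finite_T by (auto simp: envelope_def inner_prod_def intro!: Min_le)

lemma active_iff: "a \<in> active z \<longleftrightarrow> a \<in> T \<and> inner z (fst a) + snd a = envelope z"
  by (auto simp: active_def inner_prod_def)

lemma active_iff_le: "a \<in> active z \<longleftrightarrow> a \<in> T \<and> inner z (fst a) + snd a \<le> envelope z"
  using envelope_le[of a z] by (auto simp: active_iff)

lemma active_subset: "active z \<subseteq> T"
  by (auto simp: active_iff)

lemma finite_active: "finite (active z)"
  using finite_subset[OF active_subset finite_T] .

lemma active_nonempty: "active z \<noteq> {}"
proof -
  have "envelope z \<in> (\<lambda>a. inner (z, 1) a) ` T"
    unfolding envelope_def using finite_T nonempty_T by (intro Min_in) auto
  then obtain a where "a \<in> T" "envelope z = inner (z, 1) a" by blast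
  then have "a \<in> active z" by (simp add: active_def)
  then show ?thesis by blast
qed

lemma inj_on_fst_active: "inj_on fst (active z)"
  by (rule inj_onI) (auto simp: active_iff prod_eq_iff)

lemma fst_active_subset: "fst ` active z \<subseteq> dual_cell z"
  unfolding dual_cell_def by (rule hull_subset)

lemma dual_cell_nonempty: "dual_cell z \<noteq> {}"
  using fst_active_subset[of z] active_nonempty[of z] by auto

lemma aff_dim_dual_cell: "aff_dim (dual_cell z) = aff_dim (fst ` active z)"
  by (simp add: dual_cell_def aff_dim_convex_hull)

text \<open>That is, \<open>x\<close> is a supergradient of the concave function \<^const>\<open>envelope\<close> at \<open>w\<close>. This holds for
  the slopes of the active functions, which touch the envelope at \<open>w\<close> and never go below it, and
  the condition on a slope is convex.\<close>

lemma dual_cell_supergradient: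
  assumes "x \<in> dual_cell w"
  shows "envelope u - envelope w \<le> inner (u - w) x"
proof -
  have "dual_cell w \<subseteq> {x. envelope u - envelope w \<le> inner (u - w) x}"
    unfolding dual_cell_def
  proof (rule hull_minimal)
    show "convex {x. envelope u - envelope w \<le> inner (u - w) x}"
      using convex_halfspace_ge[of "envelope u - envelope w" "u - w"] by simp
    show "fst ` active w \<subseteq> {x. envelope u - envelope w \<le> inner (u - w) x}"
    proof clarify
      fix p c assume "(p, c) \<in> active w"
      then have "(p, c) \<in> T" "inner w p + c = envelope w"
        by (auto simp: active_iff)
      then show "envelope u - envelope w \<le> inner (u - w) (fst (p, c))"
        using envelope_le[of "(p, c)" u] by (simp add: inner_diff_left)
    qed
  qed
  with assms show ?thesis by blast
qed

lemma dual_cell_common_slope: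
  assumes "x \<in> dual_cell z" "x \<in> dual_cell w"
  shows "envelope z - envelope w = inner (z - w) x"
  using dual_cell_supergradient[OF assms(1), of w] dual_cell_supergradient[OF assms(2), of z]
  by (simp add: inner_diff_left)

lemma dual_cell_subset_iff: "dual_cell z \<subseteq> dual_cell w \<longleftrightarrow> active z \<subseteq> active w"
proof
  assume *: "dual_cell z \<subseteq> dual_cell w"
  show "active z \<subseteq> active w"
  proof
    fix a assume a: "a \<in> active z"
    then have "fst a \<in> dual_cell z" using fst_active_subset by blast
    with * have "envelope z - envelope w = inner (z - w) (fst a)"
      by (intro dual_cell_common_slope) auto
    with a show "a \<in> active w" by (auto simp: active_iff inner_diff_left)
  qed
next
  assume "active z \<subseteq> active w"
  then show "dual_cell z \<subseteq> dual_cell w"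
    unfolding dual_cell_def by (intro hull_mono image_mono)
qed

lemma dual_cell_eq_iff: "dual_cell z = dual_cell w \<longleftrightarrow> active z = active w"
  using dual_cell_subset_iff by (metis subset_antisym order_refl)

lemma cell_subset_iff: "cell z \<subseteq> cell w \<longleftrightarrow> active w \<subseteq> active z"
  by (auto simp: cell_def)

lemma cell_eq_iff: "cell z = cell w \<longleftrightarrow> active z = active w"
  using cell_subset_iff by (metis subset_antisym order_refl)

lemma closed_cell: "closed (cell z)"
proof -
  have "cell z = (\<Inter>a\<in>active z. \<Inter>b\<in>T. {w. inner w (fst a) + snd a \<le> inner w (fst b) + snd b})"
    (is "_ = ?I")
  proof (intro equalityI subsetI)
    fix w assume "w \<in> cell z"
    then have "inner w (fst a) + snd a = envelope w" if "a \<in> active z" for a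
      using that by (auto simp: cell_def active_iff)
    then show "w \<in> ?I" using envelope_le by simp
  next
    fix w assume w: "w \<in> ?I"
    obtain b where b: "b \<in> active w" using active_nonempty by blast
    show "w \<in> cell z"
      unfolding cell_def
    proof clarify
      fix p c assume a: "(p, c) \<in> active z"
      moreover have "b \<in> T" using b active_subset by blast
      ultimately have "inner w p + c \<le> inner w (fst b) + snd b"
        using w by force
      with a b show "(p, c) \<in> active w" by (auto simp: active_iff_le)
    qed
  qed
  also have "closed \<dots>"
    by (intro closed_INT ballI closed_Collect_le continuous_intros)
  finally show ?thesis .
qed

text \<open>On a segment from a point of the closed cell to a point of the stratum, the functions active
  at the second end are minimal throughout, and all others are strictly larger except possibly at
  the first end.\<close>

lemma active_segment:
  assumes w: "w \<in> cell z" and t: "0 < t" "t \<le> 1"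
  shows "active ((1 - t) *\<^sub>R w + t *\<^sub>R z) = active z"
proof -
  define y where "y = (1 - t) *\<^sub>R w + t *\<^sub>R z"
  have y: "inner y p + c = (1 - t) * (inner w p + c) + t * (inner z p + c)" for p c
    by (simp add: y_def inner_add_left algebra_simps)
  have ge: "(1 - t) * envelope w + t * envelope z \<le> inner y (fst a) + snd a" if "a \<in> T" for a
    unfolding y using envelope_le[OF that] t by (intro add_mono mult_left_mono) auto
  have eq: "inner y (fst a) + snd a = (1 - t) * envelope w + t * envelope z" if "a \<in> active z" for a
    unfolding y using that w by (auto simp: active_iff cell_def)
  obtain b where b: "b \<in> active z" using active_nonempty by blast
  obtain b' where b': "b' \<in> active y" using active_nonempty by blast
  have env: "envelope y = (1 - t) * envelope w + t * envelope z"
    using eq[OF b] envelope_le[of b y] ge[of b'] b b' by (auto simp: active_iff)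
  have "a \<in> active z" if a: "a \<in> active y" for a
  proof (rule ccontr)
    assume "a \<notin> active z"
    with a have *: "envelope z < inner z (fst a) + snd a" "a \<in> T"
      by (auto simp: active_iff_le not_le)
    then have "(1 - t) * envelope w + t * envelope z < inner y (fst a) + snd a"
      unfolding y using envelope_le[of a w] t
      by (intro add_le_less_mono mult_left_mono mult_strict_left_mono) auto
    with a env show False by (simp add: active_iff)
  qed
  moreover have "a \<in> active y" if "a \<in> active z" for a
    using eq[OF that] that env by (auto simp: active_iff)
  ultimately show ?thesis unfolding y_def by blast
qed

lemma stratum_subset_cell: "stratum z \<subseteq> cell z"
  by (auto simp: stratum_def cell_def)

lemma convex_stratum: "convex (stratum z)"
  unfolding convex_alt
proof (intro ballI allI impI)
  fix x y and t :: real assume x: "x \<in> stratum z" and y: "y \<in> stratum z" and t: "0 \<le> t \<and> t \<le> 1"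
  show "(1 - t) *\<^sub>R x + t *\<^sub>R y \<in> stratum z"
  proof (cases "t = 0")
    case False
    have "x \<in> cell y" using x y by (auto simp: stratum_def cell_def)
    with False t have "active ((1 - t) *\<^sub>R x + t *\<^sub>R y) = active y"
      by (intro active_segment) auto
    with y show ?thesis by (simp add: stratum_def)
  qed (use x in simp)
qed

text \<open>A point of the closed cell is approached along the segment from \<open>z\<close>.\<close>

lemma closure_stratum: "closure (stratum z) = cell z"
proof
  show "closure (stratum z) \<subseteq> cell z"
    by (intro closure_minimal stratum_subset_cell closed_cell)
  show "cell z \<subseteq> closure (stratum z)"
  proof
    fix w assume w: "w \<in> cell z"
    have "((\<lambda>t. (1 - t) *\<^sub>R w + t *\<^sub>R z) \<longlongrightarrow> (1 - 0) *\<^sub>R w + 0 *\<^sub>R z) (at_right 0)"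
      by (intro tendsto_intros)
    moreover have "eventually (\<lambda>t::real. (1 - t) *\<^sub>R w + t *\<^sub>R z \<in> stratum z) (at_right 0)"
      unfolding eventually_at_right_field
      by (rule exI[of _ 1]) (use active_segment[OF w] in \<open>auto simp: stratum_def\<close>)
    ultimately show "w \<in> closure (stratum z)"
      using closed_closure closure_subset
      by (intro Lim_in_closed_set[of "closure (stratum z)" "\<lambda>t. (1 - t) *\<^sub>R w + t *\<^sub>R z" "at_right 0"])
        (auto elim!: eventually_mono)
  qed
qed

text \<open>A function strictly above the minimum at \<open>z\<close> stays so near \<open>z\<close>.\<close>

lemma eventually_active_subset: "eventually (\<lambda>w. active w \<subseteq> active z) (nhds z)"
proof -
  have "eventually (\<lambda>w. a \<notin> active w) (nhds z)" if a: "a \<in> T - active z" for a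
  proof -
    obtain b where b: "b \<in> active z" using active_nonempty by blast
    have lim: "((\<lambda>w. (inner w (fst a) + snd a) - (inner w (fst b) + snd b)) \<longlongrightarrow>
        (inner z (fst a) + snd a) - (inner z (fst b) + snd b)) (nhds z)"
      by (intro tendsto_intros) (auto simp: filterlim_ident)
    have "inner z (fst b) + snd b < inner z (fst a) + snd a"
      using a b by (auto simp: active_iff_le)
    with lim have "eventually (\<lambda>w. 0 < (inner w (fst a) + snd a) - (inner w (fst b) + snd b)) (nhds z)"
      by (intro order_tendstoD(1)[OF lim]) auto
    then show ?thesis
    proof eventually_elim
      case (elim w)
      have "envelope w \<le> inner w (fst b) + snd b"
        using b by (intro envelope_le) (simp add: active_iff)
      with elim show ?case by (auto simp: active_iff)
    qed
  qed
  then have "eventually (\<lambda>w. \<forall>a\<in>T - active z. a \<notin> active w) (nhds z)"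
    using finite_T by (intro eventually_ball_finite) auto
  then show ?thesis
    by eventually_elim (use active_subset in blast)
qed

text \<open>The difference of the envelopes at two points is the inner product with any common active
  slope, an affine condition on the slope. It therefore extends from the active slopes at one point
  to their affine span, which by equality of dimensions contains those at the other point.\<close>

lemma active_eq_of_aff_dim_eq:
  assumes sub: "active w \<subseteq> active z" and dim: "aff_dim (dual_cell w) = aff_dim (dual_cell z)"
  shows "active w = active z"
proof
  have "affine hull (fst ` active w) = affine hull (fst ` active z)"
    using aff_dim_eq_full_gen[of "fst ` active w" "fst ` active z"] sub dim
    by (auto simp: aff_dim_dual_cell)
  moreover have "affine hull (fst ` active w) \<subseteq> {x. inner (w - z) x = envelope w - envelope z}"
  proof (rule hull_minimal)
    show "affine {x. inner (w - z) x = envelope w - envelope z}"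
      by (rule affine_hyperplane)
    show "fst ` active w \<subseteq> {x. inner (w - z) x = envelope w - envelope z}"
      using sub fst_active_subset by (fastforce simp: active_iff inner_diff_left)
  qed
  ultimately have *: "inner (w - z) (fst a) = envelope w - envelope z" if "a \<in> active z" for a
    using that hull_subset[of "fst ` active z" affine] by blast
  show "active z \<subseteq> active w"
    using * by (fastforce simp: active_iff inner_diff_left)
qed (rule sub)

lemma active_constant_on_connected:
  assumes "connected U" "\<And>z. z \<in> U \<Longrightarrow> aff_dim (dual_cell z) = k" "a \<in> U" "b \<in> U"
  shows "active a = active b"
proof (rule connected_local_const[OF assms(1,3,4)], intro ballI)
  fix z assume z: "z \<in> U"
  have "eventually (\<lambda>w. active w \<subseteq> active z) (at z within U)"
    using eventually_active_subset[of z] by (auto simp: eventually_at_filter elim: eventually_mono)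
  moreover have "eventually (\<lambda>w. w \<in> U) (at z within U)"
    by (auto simp: eventually_at_filter)
  ultimately show "eventually (\<lambda>w. active z = active w) (at z within U)"
    by eventually_elim (use active_eq_of_aff_dim_eq z assms(2) in metis)
qed

text \<open>By local constancy a connected set of points with dual cells of one dimension stays in one
  stratum, and strata are convex.\<close>

lemma components_equidimensional:
  "components {z. aff_dim (dual_cell z) = k} = stratum ` {z. aff_dim (dual_cell z) = k}"
proof -
  have "connected_component_set {z. aff_dim (dual_cell z) = k} z = stratum z"
    if z: "aff_dim (dual_cell z) = k" for z
  proof (rule connected_component_unique)
    show "z \<in> stratum z" by (simp add: stratum_def)
    show "stratum z \<subseteq> {z. aff_dim (dual_cell z) = k}"
      using z by (auto simp: stratum_def dual_cell_def)
    show "connected (stratum z)" by (rule convex_connected[OF convex_stratum])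
    fix U assume "z \<in> U" "U \<subseteq> {z. aff_dim (dual_cell z) = k}" "connected U"
    then show "U \<subseteq> stratum z"
      using active_constant_on_connected[of U k _ z] by (auto simp: stratum_def)
  qed
  then show ?thesis by (auto simp: components_def)
qed

lemma closure_components_equidimensional:
  "closure ` components {z. aff_dim (dual_cell z) = k} = cell ` {z. aff_dim (dual_cell z) = k}"
  by (simp add: components_equidimensional image_image closure_stratum)

lemma cell_perpendicular_dual_cell:
  assumes "x \<in> cell z" "y \<in> cell z" "a \<in> dual_cell z" "b \<in> dual_cell z"
  shows "inner (x - y) (a - b) = 0"
proof -
  have "dual_cell z \<subseteq> dual_cell x" "dual_cell z \<subseteq> dual_cell y"
    using assms by (auto simp: dual_cell_subset_iff cell_def)
  then have "envelope x - envelope y = inner (x - y) a" "envelope x - envelope y = inner (x - y) b"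
    using assms by (auto intro!: dual_cell_common_slope)
  then show ?thesis by (simp add: inner_diff_right)
qed

text \<open>For \<open>w\<close> in the cell the slope \<open>x\<close> gives the exact value
  \<open>envelope w = envelope z + inner (w - z) x\<close>. Every slope \<open>y\<close> in the hull of all slopes gives an upper
  bound \<open>inner w y + c\<close> with a constant \<open>c\<close>. If the hull contains the ball of radius \<open>r\<close> around \<open>x\<close>,
  the choice \<open>y = x - r w / norm w\<close> turns the comparison of the two into a bound on \<open>r * norm w\<close>.\<close>

lemma bounded_cell_interior:
  assumes "x \<in> dual_cell z" and x: "x \<in> interior (convex hull (fst ` T))"
  shows "bounded (cell z)"
proof -
  define c where "c = Max (snd ` T)"
  have upper: "envelope w \<le> inner w y + c" if y: "y \<in> convex hull (fst ` T)" for w y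
  proof -
    have "convex hull (fst ` T) \<subseteq> {y. envelope w - c \<le> inner w y}"
    proof (rule hull_minimal)
      show "convex {y. envelope w - c \<le> inner w y}"
        using convex_halfspace_ge[of "envelope w - c" w] by simp
      show "fst ` T \<subseteq> {y. envelope w - c \<le> inner w y}"
      proof clarify
        fix p e assume "(p, e) \<in> T"
        moreover from this have "e \<le> c"
          unfolding c_def using finite_T by (intro Max_ge) force+
        ultimately show "envelope w - c \<le> inner w (fst (p, e))"
          using envelope_le[of "(p, e)" w] by simp
      qed
    qed
    with y have "y \<in> {y. envelope w - c \<le> inner w y}" by blast
    then show ?thesis by simp
  qed
  obtain r where r: "r > 0" "cball x r \<subseteq> convex hull (fst ` T)"
    using x by (auto simp: mem_interior_cball)
  have "norm w \<le> (c + inner z x - envelope z) / r" if w: "w \<in> cell z" for w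
  proof -
    define y where "y = x - r *\<^sub>R sgn w"
    have "y \<in> cball x r" using r by (simp add: y_def dist_norm norm_sgn)
    then have "envelope w \<le> inner w y + c" using r upper by blast
    moreover have "dual_cell z \<subseteq> dual_cell w"
      using w by (auto simp: dual_cell_subset_iff cell_def)
    then have "envelope w - envelope z = inner (w - z) x"
      using assms(1) by (intro dual_cell_common_slope) auto
    moreover have "inner w (sgn w) = norm w"
      by (cases "w = 0") (auto simp: sgn_div_norm power2_norm_eq_inner[symmetric] power2_eq_square)
    ultimately have "norm w * r \<le> c + inner z x - envelope z"
      by (simp add: y_def inner_diff_left inner_diff_right mult.commute)
    with r show ?thesis by (simp add: pos_le_divide_eq)
  qed
  then show ?thesis by (auto simp: bounded_iff)
qed

end

text \<open>A convex set without interior points lies in a hyperplane, which supports it at every point;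
  otherwise interior and relative interior coincide.\<close>

lemma supporting_hyperplane_not_interior:
  fixes S :: "'a::euclidean_space set"
  assumes "convex S" "x \<in> S" "x \<notin> interior S"
  obtains d where "d \<noteq> 0" "\<And>y. y \<in> S \<Longrightarrow> inner d x \<le> inner d y"
proof (cases "interior S = {}")
  case True
  then obtain d b where "d \<noteq> 0" and b: "S \<subseteq> {y. inner d y = b}"
    using empty_interior_subset_hyperplane[OF assms(1)] by metis
  moreover have "inner d x \<le> inner d y" if "y \<in> S" for y
    using subsetD[OF b assms(2)] subsetD[OF b that] by simp
  ultimately show ?thesis using that by blast
next
  case False
  then have "x \<notin> rel_interior S" using assms(3) by (simp add: rel_interior_nonempty_interior)
  then show ?thesis
    using supporting_hyperplane_relative_frontier[of S x] assms closure_subset that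
    by (metis subsetD)
qed

context affine_minimum
begin

text \<open>A supporting hyperplane at the barycentre of the active slopes contains all of them, so moving
  along its normal keeps the same functions minimal.\<close>

lemma unbounded_cell_frontier:
  assumes sub: "dual_cell z \<subseteq> frontier (convex hull (fst ` T))"
  shows "\<not> bounded (cell z)"
proof -
  define x where "x = (\<Sum>p\<in>fst ` active z. (1 / real (card (fst ` active z))) *\<^sub>R p)"
  have fin: "finite (fst ` active z)" and card: "card (fst ` active z) > 0"
    using finite_active active_nonempty by (auto simp: card_gt_0_iff)
  have sum1: "(\<Sum>p\<in>fst ` active z. 1 / real (card (fst ` active z))) = 1"
    using card by simp
  have "x \<in> dual_cell z"
    unfolding x_def dual_cell_def convex_hull_finite[OF fin] using sum1
    by (intro CollectI exI[of _ "\<lambda>_. 1 / real (card (fst ` active z))"]) simp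
  then have "x \<in> frontier (convex hull (fst ` T))" using sub by blast
  moreover have "closed (convex hull (fst ` T))"
    using finite_T by (intro compact_imp_closed finite_imp_compact_convex_hull) simp
  ultimately have "x \<in> convex hull (fst ` T)" "x \<notin> interior (convex hull (fst ` T))"
    by (auto simp: frontier_def)
  then obtain d where d: "d \<noteq> 0" "\<And>y. y \<in> convex hull (fst ` T) \<Longrightarrow> inner d x \<le> inner d y"
    using supporting_hyperplane_not_interior[OF convex_convex_hull] by metis
  have dT: "inner d x \<le> inner d (fst a)" if "a \<in> T" for a
    using that by (intro d(2) hull_inc) auto
  \<comment> \<open>The average of the nonnegative numbers \<open>inner d (p - x)\<close> over the active slopes is \<open>0\<close>.\<close>
  have "(\<Sum>p\<in>fst ` active z. inner d p - inner d x) = 0"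
  proof -
    have "inner d x = (\<Sum>p\<in>fst ` active z. inner d p) / card (fst ` active z)"
      unfolding x_def inner_sum_right by (simp add: sum_divide_distrib)
    then show ?thesis using card by (simp add: sum_subtractf)
  qed
  moreover have "0 \<le> inner d p - inner d x" if "p \<in> fst ` active z" for p
    using that dT active_subset by force
  ultimately have "\<forall>p\<in>fst ` active z. inner d p - inner d x = 0"
    using sum_nonneg_eq_0_iff[OF fin, of "\<lambda>p. inner d p - inner d x"] by blast
  then have dact: "inner d (fst a) = inner d x" if "a \<in> active z" for a
    using that by simp
  have ray: "z + t *\<^sub>R d \<in> cell z" if "t \<ge> 0" for t
    unfolding cell_def
  proof clarify
    fix p c assume a: "(p, c) \<in> active z"
    obtain b where b: "b \<in> active (z + t *\<^sub>R d)" using active_nonempty by blast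
    then have bT: "b \<in> T" using active_subset by blast
    have "inner z p + c \<le> inner z (fst b) + snd b"
      using a envelope_le[OF bT, of z] by (simp add: active_iff)
    moreover have "t * inner d p \<le> t * inner d (fst b)"
      using dact[OF a] dT[OF bT] that by (intro mult_left_mono) auto
    ultimately show "(p, c) \<in> active (z + t *\<^sub>R d)"
      using a b by (auto simp: active_iff_le inner_add_left)
  qed
  show ?thesis
  proof
    assume "bounded (cell z)"
    then obtain B where B: "\<And>w. w \<in> cell z \<Longrightarrow> norm w \<le> B" by (auto simp: bounded_iff)
    define t where "t = (\<bar>B\<bar> + norm z + 1) / norm d"
    have "norm (t *\<^sub>R d) = \<bar>B\<bar> + norm z + 1"
      using d(1) by (simp add: t_def)
    moreover have "norm (z + t *\<^sub>R d) \<le> B"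
      by (intro B ray) (simp add: t_def)
    moreover have "norm (t *\<^sub>R d) \<le> norm (z + t *\<^sub>R d) + norm z"
      using norm_triangle_ineq4[of "z + t *\<^sub>R d" z] by simp
    ultimately show False by linarith
  qed
qed

lemma unbounded_cell_iff:
  "\<not> bounded (cell z) \<longleftrightarrow> dual_cell z \<subseteq> frontier (convex hull (fst ` T))"
proof -
  have "dual_cell z \<subseteq> convex hull (fst ` T)"
    unfolding dual_cell_def using active_subset by (intro hull_mono image_mono)
  moreover have "convex hull (fst ` T) \<subseteq> closure (convex hull (fst ` T))"
    by (rule closure_subset)
  ultimately show ?thesis
    using bounded_cell_interior[of _ z] unbounded_cell_frontier[of z]
    by (auto simp: frontier_def)
qed

definition corner_locus :: "'a set" where
  "corner_locus = {z. \<exists>a \<in> active z. \<exists>b \<in> active z. a \<noteq> b}"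

lemma aff_dim_dual_cell_nonneg: "0 \<le> aff_dim (dual_cell z)"
proof -
  have "aff_dim (dual_cell z) \<noteq> -1" by (metis aff_dim_empty dual_cell_nonempty)
  with aff_dim_geq[of "dual_cell z"] show ?thesis by linarith
qed

text \<open>Two distinct functions with the same slope are never active together, so two active functions
  have two slopes.\<close>

lemma corner_locus_iff: "z \<in> corner_locus \<longleftrightarrow> aff_dim (dual_cell z) \<noteq> 0"
proof -
  obtain a where a: "a \<in> active z" using active_nonempty by blast
  have "aff_dim (dual_cell z) = 0 \<longleftrightarrow> (\<exists>p. fst ` active z = {p})"
    by (simp add: aff_dim_dual_cell aff_dim_eq_0)
  also have "\<dots> \<longleftrightarrow> (\<forall>b \<in> active z. fst b = fst a)"
    using a by (auto simp: set_eq_iff image_iff) (metis fst_conv)+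
  also have "\<dots> \<longleftrightarrow> (\<forall>b \<in> active z. b = a)"
    by (intro ball_cong refl) (simp add: inj_on_eq_iff[OF inj_on_fst_active] a)
  also have "\<dots> \<longleftrightarrow> z \<notin> corner_locus"
    using a unfolding corner_locus_def mem_Collect_eq by metis
  finally show ?thesis by blast
qed

end

section \<open>Corner loci in the plane\<close>

lemma inner_eq_0_plane_iff:
  fixes n w :: "real \<times> real"
  assumes "n \<noteq> 0"
  shows "inner n w = 0 \<longleftrightarrow> (\<exists>t. w = t *\<^sub>R (- snd n, fst n))"
proof -
  obtain n1 n2 w1 w2 where nw: "n = (n1, n2)" "w = (w1, w2)" by fastforce
  have pos: "n1\<^sup>2 + n2\<^sup>2 \<noteq> 0" using assms by (simp add: nw zero_prod_def)
  show ?thesis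
  proof
    assume "inner n w = 0"
    then have e: "n1 * w1 + n2 * w2 = 0" by (simp add: nw)
    define t where "t = (w2 * n1 - w1 * n2) / (n1\<^sup>2 + n2\<^sup>2)"
    have "w1 * (n1\<^sup>2 + n2\<^sup>2) = - n2 * (w2 * n1 - w1 * n2)"
      "w2 * (n1\<^sup>2 + n2\<^sup>2) = n1 * (w2 * n1 - w1 * n2)"
      using e by algebra+
    then have "w = t *\<^sub>R (- snd n, fst n)"
      using pos by (simp add: nw t_def field_simps)
    then show "\<exists>t. w = t *\<^sub>R (- snd n, fst n)" ..
  qed (auto simp: nw)
qed

lemma aff_dim_le_1_plane:
  fixes S :: "(real \<times> real) set"
  assumes "d \<noteq> 0" "\<And>x. x \<in> S \<Longrightarrow> inner d x = b"
  shows "aff_dim S \<le> 1"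
proof -
  have "aff_dim S \<le> aff_dim {x. inner d x = b}"
    using assms(2) by (intro aff_dim_subset) auto
  with assms(1) show ?thesis by simp
qed

locale planar_affine_minimum = affine_minimum T for T :: "((real \<times> real) \<times> real) set"
begin

lemma aff_dim_dual_cell_cases:
  obtains "aff_dim (dual_cell z) = 0" | "aff_dim (dual_cell z) = 1" | "aff_dim (dual_cell z) = 2"
proof -
  have "aff_dim (dual_cell z) \<le> 2" using aff_dim_le_DIM[of "dual_cell z"] by simp
  with aff_dim_dual_cell_nonneg[of z]
  have "aff_dim (dual_cell z) = 0 \<or> aff_dim (dual_cell z) = 1 \<or> aff_dim (dual_cell z) = 2"
    by linarith
  with that show thesis by blast
qed

text \<open>Near \<open>v\<close> only functions active at \<open>v\<close> can be active, and their slopes lie on a line with direction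
  \<open>n\<close>. Along the line through \<open>v\<close> orthogonal to \<open>n\<close> they all keep equal values; off it no two of them
  agree.\<close>

lemma corner_locus_locally_line:
  assumes dim: "aff_dim (dual_cell v) = 1"
  shows "\<exists>d e. d \<noteq> 0 \<and> e > 0 \<and> corner_locus \<inter> ball v e = range (\<lambda>t. v + t *\<^sub>R d) \<inter> ball v e"
proof -
  have "v \<in> corner_locus" using dim by (simp add: corner_locus_iff)
  then obtain a b where ab: "a \<in> active v" "b \<in> active v" "fst a \<noteq> fst b"
    using inj_onD[OF inj_on_fst_active] unfolding corner_locus_def by blast
  define n where "n = fst a - fst b"
  have n: "n \<noteq> 0" using ab by (simp add: n_def)
  have "affine hull {fst a, fst b} = affine hull (fst ` active v)"
    using ab dim aff_dim_eq_full_gen[of "{fst a, fst b}" "fst ` active v"]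
    by (simp add: aff_dim_dual_cell aff_dim_2)
  then have span: "fst ` active v \<subseteq> affine hull {fst a, fst b}"
    by (simp add: hull_subset)
  obtain e where e: "e > 0" "\<And>w. w \<in> ball v e \<Longrightarrow> active w \<subseteq> active v"
    using eventually_active_subset[of v] by (auto simp: eventually_nhds_metric dist_commute)
  have "w \<in> corner_locus \<longleftrightarrow> inner n (w - v) = 0" if w: "w \<in> ball v e" for w
  proof
    assume "w \<in> corner_locus"
    then have "aff_dim (dual_cell w) \<noteq> 0" by (simp add: corner_locus_iff)
    moreover have "aff_dim (dual_cell w) \<le> 1"
      using e(2)[OF w] dim aff_dim_subset by (metis dual_cell_subset_iff)
    ultimately have "aff_dim (dual_cell w) = aff_dim (dual_cell v)"
      using aff_dim_dual_cell_nonneg[of w] dim by linarith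
    then have "active w = active v"
      by (rule active_eq_of_aff_dim_eq[OF e(2)[OF w]])
    then have "w \<in> cell v" "v \<in> cell v" by (auto simp: cell_def)
    moreover have "fst a \<in> dual_cell v" "fst b \<in> dual_cell v"
      using ab fst_active_subset by blast+
    ultimately show "inner n (w - v) = 0"
      unfolding n_def by (subst inner_commute) (rule cell_perpendicular_dual_cell)
  next
    assume "inner n (w - v) = 0"
    then have "affine hull {fst a, fst b} \<subseteq> {x. inner (w - v) x = inner (w - v) (fst a)}"
      by (intro hull_minimal affine_hyperplane) (auto simp: n_def inner_diff inner_commute)
    with span have *: "inner (w - v) (fst c) = inner (w - v) (fst a)" if "c \<in> active v" for c
      using that by blast
    obtain c where c: "c \<in> active w" "c \<in> active v" using active_nonempty e(2)[OF w] by blast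
    have "active v \<subseteq> active w"
    proof
      fix c' assume c': "c' \<in> active v"
      show "c' \<in> active w"
        using *[OF c'] *[OF c(2)] c c' by (auto simp: active_iff inner_diff_left)
    qed
    then show "w \<in> corner_locus"
      using \<open>v \<in> corner_locus\<close> unfolding corner_locus_def by blast
  qed
  moreover have "inner n (w - v) = 0 \<longleftrightarrow> w \<in> range (\<lambda>t. v + t *\<^sub>R (- snd n, fst n))" for w
    unfolding inner_eq_0_plane_iff[OF n] by (auto simp: algebra_simps image_iff)
  ultimately have "corner_locus \<inter> ball v e =
      range (\<lambda>t. v + t *\<^sub>R (- snd n, fst n)) \<inter> ball v e"
    by blast
  moreover have "(- snd n, fst n) \<noteq> 0" using n by (cases n) (auto simp: zero_prod_def)
  ultimately show ?thesis using e(1) by blast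
qed

text \<open>If the corner locus were a line near \<open>v\<close>, the envelope would be a single affine function \<open>a\<close> on
  a half-disc bounded by the line. Every function active at \<open>v\<close> is then at least \<open>a\<close> on the half-disc
  and equal to \<open>a\<close> at the boundary point \<open>v\<close>, so it agrees with \<open>a\<close> along the line. Hence all active slopes
  would be collinear.\<close>

lemma corner_locus_not_locally_line:
  assumes dim: "aff_dim (dual_cell v) = 2" and "d \<noteq> 0" "e > 0"
  shows "corner_locus \<inter> ball v e \<noteq> range (\<lambda>t. v + t *\<^sub>R d) \<inter> ball v e"
proof
  assume line: "corner_locus \<inter> ball v e = range (\<lambda>t. v + t *\<^sub>R d) \<inter> ball v e"
  define n where "n = (- snd d, fst d)"
  have n: "n \<noteq> 0" using \<open>d \<noteq> 0\<close> by (auto simp: n_def prod_eq_iff)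
  have nd: "inner n d = 0" by (simp add: n_def inner_prod_def)
  obtain e' where e': "e' > 0" "\<And>w. w \<in> ball v e' \<Longrightarrow> active w \<subseteq> active v"
    using eventually_active_subset[of v] by (auto simp: eventually_nhds_metric dist_commute)
  define r where "r = min e e'"
  have r: "r > 0" "ball v r \<subseteq> ball v e" "ball v r \<subseteq> ball v e'"
    using \<open>e > 0\<close> e'(1) by (auto simp: r_def)
  define H where "H = ball v r \<inter> {w. inner n w > inner n v}"
  have "convex H"
    unfolding H_def by (intro convex_Int convex_ball convex_halfspace_gt)
  have H0: "aff_dim (dual_cell w) = 0" if "w \<in> H" for w
  proof -
    have "w \<notin> range (\<lambda>t. v + t *\<^sub>R d)"
      using that nd by (auto simp: H_def inner_add_right)
    moreover have "w \<in> ball v e" using that r(2) by (auto simp: H_def)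
    ultimately have "w \<notin> corner_locus" using line by blast
    then show ?thesis by (simp add: corner_locus_iff)
  qed
  have inH: "\<exists>s>0. v + s *\<^sub>R u \<in> H" if u: "inner n u > 0" for u
  proof -
    have "u \<noteq> 0" using u by auto
    define s where "s = r / (2 * norm u)"
    have "s > 0" "norm (s *\<^sub>R u) < r"
      using r(1) \<open>u \<noteq> 0\<close> by (auto simp: s_def)
    then have "v + s *\<^sub>R u \<in> H"
      using u by (auto simp: H_def dist_norm inner_add_right)
    with \<open>s > 0\<close> show ?thesis by blast
  qed
  have nn: "inner n n > 0" using n by simp
  then obtain w0 where w0: "w0 \<in> H" using inH by blast
  obtain a where a: "a \<in> active w0" using active_nonempty by blast
  have aH: "a \<in> active w" if "w \<in> H" for w
    using active_constant_on_connected[OF convex_connected[OF \<open>convex H\<close>] H0 that w0] a by simp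
  have "w0 \<in> ball v e'" using w0 r(3) by (auto simp: H_def)
  then have av: "a \<in> active v" using a e'(2) by blast
  have "inner (fst c - fst a) d = 0" if c: "c \<in> active v" for c
  proof -
    have ge: "inner (fst c - fst a) u \<ge> 0" if "inner n u > 0" for u
    proof -
      obtain s where s: "s > 0" "v + s *\<^sub>R u \<in> H" using inH[OF \<open>inner n u > 0\<close>] by blast
      have "c \<in> T" using c active_subset by blast
      then have "s * inner (fst c - fst a) u \<ge> 0"
        using aH[OF s(2)] envelope_le[of c "v + s *\<^sub>R u"] c av
        by (simp add: active_iff inner_simps inner_commute algebra_simps)
      with s(1) show ?thesis by (simp add: zero_le_mult_iff)
    qed
    define k where "k = inner (fst c - fst a) d"
    define m where "m = inner (fst c - fst a) n"
    have "0 \<le> m + t * k" for t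
      using ge[of "n + t *\<^sub>R d"] nn nd by (simp add: inner_add_right k_def m_def)
    \<comment> \<open>An affine function of \<open>t\<close> that is bounded below is constant.\<close>
    from this[of "- (m + 1) / k"] have "k = 0"
      by (cases "k = 0") auto
    then show ?thesis by (simp add: k_def)
  qed
  then have "inner d (fst c) = inner d (fst a)" if "c \<in> active v" for c
    using that by (simp add: inner_diff_left inner_diff_right inner_commute)
  then have "aff_dim (fst ` active v) \<le> 1"
    by (intro aff_dim_le_1_plane[OF \<open>d \<noteq> 0\<close>]) blast
  with dim show False by (simp add: aff_dim_dual_cell)
qed

lemma curve_vertices_corner_locus: "curve_vertices corner_locus = {z. aff_dim (dual_cell z) = 2}"
proof (intro equalityI subsetI)
  fix z assume "z \<in> curve_vertices corner_locus"
  then show "z \<in> {z. aff_dim (dual_cell z) = 2}"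
    using corner_locus_locally_line[of z]
    by (cases z rule: aff_dim_dual_cell_cases) (auto simp: curve_vertices_def corner_locus_iff)
next
  fix z assume "z \<in> {z. aff_dim (dual_cell z) = 2}"
  then show "z \<in> curve_vertices corner_locus"
    using corner_locus_not_locally_line[of z] by (auto simp: curve_vertices_def corner_locus_iff)
qed

lemma cell_eq_singleton:
  assumes "aff_dim (dual_cell z) = 2"
  shows "cell z = {z}"
proof -
  have "w = z" if w: "w \<in> cell z" for w
  proof (rule ccontr)
    assume "w \<noteq> z"
    obtain x where x: "x \<in> dual_cell z" using dual_cell_nonempty by blast
    have "inner (w - z) y = inner (w - z) x" if "y \<in> dual_cell z" for y
      using cell_perpendicular_dual_cell[OF w _ that x] by (simp add: cell_def inner_diff_right)
    then have "aff_dim (dual_cell z) \<le> 1"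
      using \<open>w \<noteq> z\<close> by (intro aff_dim_le_1_plane[of "w - z" _ "inner (w - z) x"]) auto
    with assms show False by simp
  qed
  then show ?thesis by (auto simp: cell_def)
qed

lemma region_cells_corner_locus:
  "region_cells corner_locus = cell ` {z. aff_dim (dual_cell z) = 0}"
proof -
  have "- corner_locus = {z. aff_dim (dual_cell z) = 0}" by (auto simp: corner_locus_iff)
  then show ?thesis by (simp add: region_cells_def closure_components_equidimensional)
qed

lemma edge_cells_corner_locus:
  "edge_cells corner_locus = cell ` {z. aff_dim (dual_cell z) = 1}"
proof -
  have "corner_locus - curve_vertices corner_locus = {z. aff_dim (dual_cell z) = 1}"
  proof (rule Set.set_eqI)
    fix z
    show "z \<in> corner_locus - curve_vertices corner_locus \<longleftrightarrow> z \<in> {z. aff_dim (dual_cell z) = 1}"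
      by (cases z rule: aff_dim_dual_cell_cases) (auto simp: curve_vertices_corner_locus corner_locus_iff)
  qed
  then show ?thesis by (simp add: edge_cells_def closure_components_equidimensional)
qed

lemma vertex_cells_corner_locus:
  "vertex_cells corner_locus = cell ` {z. aff_dim (dual_cell z) = 2}"
  unfolding vertex_cells_def curve_vertices_corner_locus
  by (intro image_cong) (simp_all add: cell_eq_singleton)

lemma all_cells_corner_locus:
  "vertex_cells corner_locus \<union> edge_cells corner_locus \<union> region_cells corner_locus = range cell"
proof -
  have "{z. aff_dim (dual_cell z) = 2} \<union> {z. aff_dim (dual_cell z) = 1} \<union>
      {z. aff_dim (dual_cell z) = 0} = UNIV"
    using aff_dim_dual_cell_cases by blast
  then show ?thesis
    unfolding vertex_cells_corner_locus edge_cells_corner_locus region_cells_corner_locus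
      image_Un[symmetric] by simp
qed

text \<open>The duality sends the cell through \<open>z\<close> to the dual cell of \<open>z\<close>, which is independent of the choice
  of \<open>z\<close> because both are determined by the functions active at \<open>z\<close>.\<close>

theorem corner_locus_dual:
  "dual_to_subdivision corner_locus (convex hull (fst ` T)) (range dual_cell)"
proof -
  define \<phi> where "\<phi> c = dual_cell (SOME z. cell z = c)" for c
  have \<phi>: "\<phi> (cell z) = dual_cell z" for z
  proof -
    have "cell (SOME w. cell w = cell z) = cell z" by (rule someI) (rule refl)
    then show ?thesis by (simp add: \<phi>_def cell_eq_iff dual_cell_eq_iff)
  qed
  have "bij_betw \<phi> (range cell) (range dual_cell)"
    unfolding bij_betw_def
    by (auto simp: inj_on_def \<phi> cell_eq_iff dual_cell_eq_iff image_image)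
  moreover have "\<forall>c\<in>range cell. \<forall>c'\<in>range cell. c \<subseteq> c' \<longleftrightarrow> \<phi> c' \<subseteq> \<phi> c"
    by (auto simp: \<phi> cell_subset_iff dual_cell_subset_iff)
  ultimately show ?thesis
    unfolding dual_to_subdivision_def all_cells_corner_locus
    by (intro exI[of _ \<phi>])
      (simp add: vertex_cells_corner_locus edge_cells_corner_locus region_cells_corner_locus \<phi>
        cell_perpendicular_dual_cell unbounded_cell_iff)
qed

end

section \<open>Lower faces\<close>

context affine_minimum
begin

text \<open>A hyperplane supporting the hull from below with normal \<open>(u, 1)\<close> has the offset \<open>envelope u\<close>,
  and the face it cuts out is spanned by the points of \<open>T\<close> that it contains.\<close>

lemma lower_face_convex_hull_iff:
  fixes F :: "('a \<times> real) set"
  shows "(\<exists>u b. F \<noteq> {} \<and> convex hull T \<subseteq> {p. b \<le> inner (u, 1) p} \<and>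
      F = convex hull T \<inter> {p. inner (u, 1) p = b}) \<longleftrightarrow> (\<exists>z. F = convex hull (active z))"
proof -
  have ge: "convex hull T \<subseteq> {p. envelope u \<le> inner (u, 1) p}" for u
  proof (rule hull_minimal)
    show "T \<subseteq> {p. envelope u \<le> inner (u, 1) p}"
      using envelope_le by (auto simp: inner_prod_def)
    show "convex {p. envelope u \<le> inner (u, 1) p}" by (rule convex_halfspace_ge)
  qed
  have face: "convex hull T \<inter> {p. inner (u, 1) p = envelope u} = convex hull (active u)" for u
  proof
    have "(convex hull T \<inter> {p. inner (u, 1) p = envelope u}) face_of (convex hull T)"
      using ge by (intro face_of_Int_supporting_hyperplane_ge) auto
    then obtain S where S: "S \<subseteq> T" "convex hull T \<inter> {p. inner (u, 1) p = envelope u} = convex hull S"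
      using face_of_convex_hull_subset[OF finite_imp_compact[OF finite_T]] by metis
    then have "S \<subseteq> active u"
      using hull_subset[of S convex] by (auto simp: active_def)
    with S show "convex hull T \<inter> {p. inner (u, 1) p = envelope u} \<subseteq> convex hull (active u)"
      by (simp add: hull_mono)
    show "convex hull (active u) \<subseteq> convex hull T \<inter> {p. inner (u, 1) p = envelope u}"
      by (intro hull_minimal convex_Int convex_convex_hull convex_hyperplane)
        (auto simp: active_def intro: hull_inc)
  qed
  have "b = envelope u"
    if "F \<noteq> {}" "convex hull T \<subseteq> {p. b \<le> inner (u, 1) p}"
      "F = convex hull T \<inter> {p. inner (u, 1) p = b}" for u b
  proof (rule antisym)
    obtain a where "a \<in> active u" using active_nonempty by blast
    then have "a \<in> convex hull T" "inner (u, 1) a = envelope u"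
      by (auto simp: active_def intro: hull_inc)
    with that(2) show "b \<le> envelope u" by auto
    show "envelope u \<le> b" using that(1,3) ge[of u] by auto
  qed
  then show ?thesis
    using ge face active_nonempty by (metis convex_hull_eq_empty)
qed

lemma fst_convex_hull_active: "fst ` (convex hull (active z)) = dual_cell z"
  unfolding dual_cell_def by (rule convex_hull_linear_image[OF linear_fst])

end

lemma (in planar_affine_minimum) projected_lower_faces:
  "{fst ` F | F. lower_face F (convex hull T)} = range dual_cell"
proof -
  have "lower_face F (convex hull T) \<longleftrightarrow> (\<exists>z. F = convex hull (active z))" for F
    using lower_face_convex_hull_iff[of F] by (auto simp: lower_face_def)
  then show ?thesis by (auto simp: fst_convex_hull_active[symmetric])
qed

section \<open>Tropical curves\<close>

definition lifted_exponent :: "nat \<times> nat \<times> nat \<Rightarrow> (real \<times> real) \<times> real" where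
  "lifted_exponent = (\<lambda>(i, j, k). ((real i, real j), - real k))"

lemma inj_lifted_exponent: "inj lifted_exponent"
  by (auto simp: inj_def lifted_exponent_def)

lemma tropical_monomial_eq: "tropical_monomial a z = inner (z, 1) (lifted_exponent a)"
  by (cases a; cases z) (simp add: tropical_monomial_def lifted_exponent_def algebra_simps)

lemma finite_exponents: "finite (exponents P)"
proof -
  have "exponents P \<subseteq> (SIGMA i:{..degree P}. SIGMA j:{..degree (coeff P i)}.
      {..degree (coeff (coeff P i) j)})"
  proof
    fix e assume "e \<in> exponents P"
    moreover obtain i j k where e: "e = (i, j, k)" by (cases e)
    ultimately have "coeff (coeff (coeff P i) j) k \<noteq> 0" by (simp add: exponents_def)
    moreover from this have "coeff (coeff P i) j \<noteq> 0" by auto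
    moreover from this have "coeff P i \<noteq> 0" by auto
    ultimately show "e \<in> (SIGMA i:{..degree P}. SIGMA j:{..degree (coeff P i)}.
        {..degree (coeff (coeff P i) j)})"
      by (auto simp: e intro: le_degree)
  qed
  then show ?thesis by (rule finite_subset) auto
qed

lemma exponents_nonempty:
  assumes "P \<noteq> 0"
  shows "exponents P \<noteq> {}"
proof -
  have "coeff (coeff (coeff P (degree P)) (degree (lead_coeff P))) (degree (lead_coeff (lead_coeff P))) \<noteq> 0"
    using assms by simp
  then have "(degree P, degree (lead_coeff P), degree (lead_coeff (lead_coeff P))) \<in> exponents P"
    by (simp add: exponents_def)
  then show ?thesis by blast
qed

lemma tropical_curve_dual_to_newton_subdivision:
  assumes "P \<noteq> 0"
  shows "\<exists>\<S>. newton_subdivision (newton_polygon_0 P) \<S> \<and>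
           dual_to_subdivision (tropical_curve P) (newton_polygon_0 P) \<S>"
proof -
  define T where "T = lifted_exponent ` exponents P"
  interpret planar_affine_minimum T
    by unfold_locales (use assms in \<open>auto simp: T_def finite_exponents exponents_nonempty\<close>)
  have "(\<lambda>a. tropical_monomial a z) ` exponents P = (\<lambda>a. inner (z, 1) a) ` T" for z
    by (simp add: T_def image_image tropical_monomial_eq)
  then have envelope: "tropical_polynomial P z = envelope z" for z
    by (simp add: tropical_polynomial_def envelope_def)
  have "active z = lifted_exponent ` {a \<in> exponents P. tropical_monomial a z = tropical_polynomial P z}" for z
    unfolding active_def envelope tropical_monomial_eq unfolding T_def by blast
  then have curve: "tropical_curve P = corner_locus"
    unfolding tropical_curve_def corner_locus_def
    by (simp add: inj_eq[OF inj_lifted_exponent] del: split_paired_Ex) blast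
  have polygon: "newton_polygon_0 P = convex hull (fst ` T)"
    unfolding newton_polygon_0_def T_def image_image
    by (simp add: lifted_exponent_def case_prod_unfold)
  have "newton_subdivision (newton_polygon_0 P) (range dual_cell)"
  proof -
    define X :: "((int \<times> int) \<times> rat) set"
      where "X = (\<lambda>(i, j, k). ((int i, int j), - of_nat k)) ` exponents P"
    have "finite X" by (simp add: X_def finite_exponents)
    moreover have "(\<lambda>((i, j), c). ((real_of_int i, real_of_int j), real_of_rat c)) ` X = T"
      unfolding X_def T_def image_image
      by (simp add: lifted_exponent_def case_prod_unfold of_rat_minus)
    moreover have "(\<lambda>((i, j), c). (real_of_int i, real_of_int j)) ` X = fst ` T"
      unfolding X_def T_def image_image by (simp add: lifted_exponent_def case_prod_unfold)
    ultimately show ?thesis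
      unfolding newton_subdivision_def polygon projected_lower_faces[symmetric]
      by (intro exI[of _ X]) auto
  qed
  with corner_locus_dual show ?thesis
    unfolding curve polygon by blast
qed

theorem proposition3p2:
  fixes K :: "(real^3) set"
    and P :: "int poly poly poly"
    and A :: "int poly poly"
    and B :: "int poly"
  assumes "knot K"
    and "noncommutative_A_polynomial K P"
    and "A_polynomial K A"
    and "good P"
    and "at_q_one P = [:B:] * sqrt_M A"
  shows "\<exists>\<S>. newton_subdivision (newton_polygon (sqrt_M A * [:B:])) \<S> \<and>
           dual_to_subdivision (tropical_curve P) (newton_polygon (sqrt_M A * [:B:])) \<S>"
proof -
  have "content P = 1"
    using assms(2) by (simp add: noncommutative_A_polynomial_def homogeneous_annihilator_def)
  then have "P \<noteq> 0" by auto
  moreover have "newton_polygon (sqrt_M A * [:B:]) = newton_polygon_0 P"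
    using assms(4,5) by (simp only: good_def newton_polygon_1_def mult.commute)
  ultimately show ?thesis
    using tropical_curve_dual_to_newton_subdivision by metis
qed

end
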